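(* Let $\mathfrak{L}$ be a Lie algebra over $\mathbb{C}$ all of whose $\frac12$-derivations are trivial. Then every transposed Poisson algebra structure $(\mathfrak{L},\cdot,[\;,\;])$ defined on $\mathfrak{L}$ is trivial.
   Context: All vector spaces and algebras are over $\mathbb{C}$. A $\frac12$-derivation of a Lie algebra $(\mathfrak{L},[\;,\;])$ is a linear map $\varphi:\mathfrak{L}\to\mathfrak{L}$ with $\varphi([x,y])=\frac12\left([\varphi(x),y]+[x,\varphi(y)]\right)$ for all $x,y$; it is trivial if it is multiplication by an element of $\mathbb{C}$. A transposed Poisson algebra structure on a Lie algebra $(\mathfrak{L},[\;,\;])$ is a bilinear operation $\cdot$ on $\mathfrak{L}$ such that $(\mathfrak{L},\cdot)$ is commutative and associative (not necessarily unital) and $2z\cdot[x,y]=[z\cdot x,y]+[x,z\cdot y]$ for all $x,y,z\in\mathfrak{L}$. The structure is trivial if at least one of the two operations $\cdot$, $[\;,\;]$ is identically zero. *)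

theory Defs
  imports Complex_Main
begin

text \<open>
  Complex vector spaces are given by a scalar multiplication \<open>scale\<close> on an abelian group type
  \<open>'a\<close>; the underlying space is the whole type. No finiteness of dimension is assumed.
\<close>

definition bilinear_op ::
    "(complex \<Rightarrow> 'a \<Rightarrow> 'a) \<Rightarrow> ('a::ab_group_add \<Rightarrow> 'a \<Rightarrow> 'a) \<Rightarrow> bool" where
  "bilinear_op scale f \<longleftrightarrow>
     (\<forall>x. Vector_Spaces.linear scale scale (\<lambda>y. f x y)) \<and>
     (\<forall>y. Vector_Spaces.linear scale scale (\<lambda>x. f x y))"

locale lie_algebra = vector_space scale
  for scale :: "complex \<Rightarrow> 'a::ab_group_add \<Rightarrow> 'a" +
  fixes bracket :: "'a \<Rightarrow> 'a \<Rightarrow> 'a"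
  assumes bracket_bilinear: "bilinear_op scale bracket"
    and bracket_alternating: "bracket x x = 0"
    and jacobi: "bracket x (bracket y z) + bracket y (bracket z x) + bracket z (bracket x y) = 0"

definition half_derivation ::
    "(complex \<Rightarrow> 'a \<Rightarrow> 'a) \<Rightarrow> ('a::ab_group_add \<Rightarrow> 'a \<Rightarrow> 'a) \<Rightarrow> ('a \<Rightarrow> 'a) \<Rightarrow> bool" where
  "half_derivation scale bracket \<phi> \<longleftrightarrow>
     Vector_Spaces.linear scale scale \<phi> \<and>
     (\<forall>x y. \<phi> (bracket x y) = scale (1/2) (bracket (\<phi> x) y + bracket x (\<phi> y)))"

definition trivial_half_derivation ::
    "(complex \<Rightarrow> 'a \<Rightarrow> 'a) \<Rightarrow> ('a \<Rightarrow> 'a) \<Rightarrow> bool" where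
  "trivial_half_derivation scale \<phi> \<longleftrightarrow> (\<exists>c. \<forall>x. \<phi> x = scale c x)"

locale transposed_poisson_algebra = lie_algebra scale bracket
  for scale :: "complex \<Rightarrow> 'a::ab_group_add \<Rightarrow> 'a"
    and bracket :: "'a \<Rightarrow> 'a \<Rightarrow> 'a" +
  fixes mult :: "'a \<Rightarrow> 'a \<Rightarrow> 'a"
  assumes mult_bilinear: "bilinear_op scale mult"
    and mult_commute: "mult x y = mult y x"
    and mult_assoc: "mult (mult x y) z = mult x (mult y z)"
    and transposed_leibniz:
      "scale 2 (mult z (bracket x y)) = bracket (mult z x) y + bracket x (mult z y)"

definition trivial_structure ::
    "('a::zero \<Rightarrow> 'a \<Rightarrow> 'a) \<Rightarrow> ('a \<Rightarrow> 'a \<Rightarrow> 'a) \<Rightarrow> bool" where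
  "trivial_structure bracket mult \<longleftrightarrow>
     (\<forall>x y. mult x y = 0) \<or> (\<forall>x y. bracket x y = 0)"

end

theory Submission
  imports Defs
begin

text \<open>
  The compatibility identity says exactly that multiplication by a fixed element \<open>z\<close> is a
  \<open>1/2\<close>-derivation (\<open>left_mult_half_derivation\<close>), so by hypothesis it is multiplication by a scalar
  \<open>c z\<close>. Commutativity then reads \<open>c x y = c y x\<close>, which on linearly independent \<open>x\<close>, \<open>y\<close>
  forces \<open>c x = 0\<close>, and hence \<open>c = 0\<close> everywhere: a space of dimension at least two carries no
  nonzero commutative product of this kind (\<open>commutative_scalar_product_eq_zero\<close>). A nonzero bracket
  supplies the independent pair, because it is alternating. Hence a bracket that is not zero leaves
  only the zero product.
\<close>

text \<open>
  The assumption \<open>y \<notin> span {x}\<close> cannot be dropped: on a line, \<open>c\<close> may be any linear form.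
\<close>

lemma (in vector_space) commutative_scalar_product_eq_zero:
  assumes commute: "\<And>u v. f u v = f v u"
    and scalar: "\<And>u v. f u v = c u *s v"
    and "x \<noteq> 0" and "y \<notin> span {x}"
  shows "f u v = 0"
proof -
  have swap: "c u *s v = c v *s u" for u v
    using commute scalar by metis
  have "c x = 0"
  proof (rule ccontr)
    assume "c x \<noteq> 0"
    then have "y = inverse (c x) *s (c x *s y)"
      by simp
    also have "\<dots> = (inverse (c x) * c y) *s x"
      by (simp only: swap[of x y] scale_scale)
    finally have "y \<in> span {x}"
      by (metis span_base span_scale singletonI)
    with \<open>y \<notin> span {x}\<close> show False ..
  qed
  with swap[of u x] \<open>x \<noteq> 0\<close> have "c u = 0"
    by simp
  then show ?thesis
    by (simp add: scalar)
qed

lemma (in lie_algebra) bracket_nonzero_imp_independent: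
  assumes "bracket x y \<noteq> 0"
  shows "x \<noteq> 0" and "y \<notin> span {x}"
proof -
  have "Vector_Spaces.linear scale scale (\<lambda>u. bracket u y)"
    using bracket_bilinear by (simp add: bilinear_op_def)
  then interpret left: Vector_Spaces.linear scale scale "\<lambda>u. bracket u y" .
  have "Vector_Spaces.linear scale scale (bracket x)"
    using bracket_bilinear by (simp add: bilinear_op_def)
  then interpret right: Vector_Spaces.linear scale scale "bracket x" .
  show "x \<noteq> 0"
    using assms left.zero by auto
  show "y \<notin> span {x}"
    using assms by (auto simp: span_singleton right.scale bracket_alternating)
qed

lemma (in transposed_poisson_algebra) left_mult_half_derivation:
  "half_derivation scale bracket (mult z)"
proof -
  have "mult z (bracket x y) = scale (1/2) (bracket (mult z x) y + bracket x (mult z y))" for x y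
    by (simp flip: transposed_leibniz)
  moreover have "Vector_Spaces.linear scale scale (mult z)"
    using mult_bilinear by (simp add: bilinear_op_def)
  ultimately show ?thesis
    by (simp add: half_derivation_def)
qed

theorem theorem7:
  fixes scale :: "complex \<Rightarrow> 'a::ab_group_add \<Rightarrow> 'a"
    and bracket :: "'a \<Rightarrow> 'a \<Rightarrow> 'a"
  assumes "lie_algebra scale bracket"
    and "\<forall>\<phi>. half_derivation scale bracket \<phi> \<longrightarrow> trivial_half_derivation scale \<phi>"
  shows "\<forall>mult. transposed_poisson_algebra scale bracket mult \<longrightarrow> trivial_structure bracket mult"
proof (intro allI impI)
  fix mult
  assume "transposed_poisson_algebra scale bracket mult"
  then interpret transposed_poisson_algebra scale bracket mult .
  have "\<forall>z. \<exists>c. \<forall>x. mult z x = scale c x"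
    using assms(2) left_mult_half_derivation unfolding trivial_half_derivation_def by blast
  then obtain c where c: "\<And>z x. mult z x = scale (c z) x"
    by metis
  show "trivial_structure bracket mult"
  proof (cases "\<forall>x y. bracket x y = 0")
    case True
    then show ?thesis
      by (simp add: trivial_structure_def)
  next
    case False
    then obtain x y where "bracket x y \<noteq> 0"
      by blast
    note independent = bracket_nonzero_imp_independent[OF this]
    have "mult u v = 0" for u v
      by (rule commutative_scalar_product_eq_zero[OF mult_commute c independent])
    then show ?thesis
      by (simp add: trivial_structure_def)
  qed
qed

end
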